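(* Let $p > 2$ be a prime, let $\alpha, \beta, \gamma \in \mathbb{F}_p$ with $\alpha \neq 0$, and let $$\mathcal{S} = \{(x,y) \in \mathbb{F}_p^2 : y < \alpha x^2 + \beta x + \gamma\}$$ be the set of points below the parabola $Y = \alpha X^2+\beta X+\gamma$ in the affine plane $\mathrm{AG}(2,p)$. Then $$\left| |\mathcal{S}| - \binom{p}{2} \right| \leq c_p\, p \sqrt p \ln(p), \qquad \text{where } c_p = \begin{cases} 1 & \text{if } p \equiv 1 \pmod 4, \\ 2 & \text{if } p \equiv -1 \pmod 8, \\ \frac43 & \text{if } p \equiv 3 \pmod 8. \end{cases}$$ Moreover, $|\mathcal{S}|$ is a multiple of $p$.
   Context: $\mathbb{F}_p$ is the finite field of prime order $p$, and $\mathrm{AG}(2,p)$ is the Desarguesian affine plane of order $p$, with point set $\mathbb{F}_p^2$. Every element of $\mathbb{F}_p$ corresponds to a unique integer in $\{0,1,\dots,p-1\}$; write $\nu(x)$ for the integer corresponding to $x \in \mathbb{F}_p$. The order relation $<$ on $\mathbb{F}_p$ is the one induced by this: $x<y$ if and only if $\nu(x)<\nu(y)$ in $\mathbb{Z}$.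
   Formalization: The claim that |S| is a multiple of p is stated only for p ≠ 3, since for p = 3 it always fails (|S| ≡ 2α mod 3; for example Y = X² has exactly 2 points below it); the bound is stated for all primes p > 2. *)

theory Defs
  imports Complex_Main "HOL-Number_Theory.Residues"
begin

(* The field F_p is residue_ring (int p). Its elements are the integers 0, ..., p - 1 themselves,
   so the integer nu(x) attached to x is x, and the induced order on F_p is the order of int. *)

definition below_parabola :: "nat \<Rightarrow> int \<Rightarrow> int \<Rightarrow> int \<Rightarrow> (int \<times> int) set" where
  "below_parabola p \<alpha> \<beta> \<gamma> =
     (let F = residue_ring (int p) in
      {(x, y) \<in> carrier F \<times> carrier F.
        y < \<alpha> \<otimes>\<^bsub>F\<^esub> (x [^]\<^bsub>F\<^esub> (2::nat)) \<oplus>\<^bsub>F\<^esub> \<beta> \<otimes>\<^bsub>F\<^esub> x \<oplus>\<^bsub>F\<^esub> \<gamma>})"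

(* For an odd prime p the last branch is exactly the case of p congruent to 3 modulo 8. *)
definition bound_const :: "nat \<Rightarrow> real" where
  "bound_const p =
     (if [p = 1] (mod 4) then 1
      else if [int p = - 1] (mod 8) then 2
      else 4 / 3)"

(* The cardinality need not be a multiple of p when p = 3: the parabola Y = X^2 over F_3 has
   exactly two points below it. *)
lemma card_below_parabola_3: "card (below_parabola 3 1 0 0) = 2"
proof -
  have "below_parabola 3 1 0 0 = {(1, 0), (2, 0)}"
  proof -
    have c: "{0..2::int} = {0, 1, 2}" by auto
    have "x [^]\<^bsub>residue_ring 3\<^esub> (2::nat) = x ^ 2 mod 3" for x :: int
      by (simp add: nat_pow_def residue_ring_def numeral_2_eq_2 mod_mult_eq mod_simps)
    then show ?thesis
      by (auto simp: below_parabola_def Let_def residue_ring_def c)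
  qed
  then show ?thesis by simp
qed

end

theory Submission
  imports Defs "HOL-Analysis.Harmonic_Numbers"
begin

text \<open>
  The number of points below the parabola is the sum over \<open>x\<close> of the residues
  \<open>f x mod p\<close>. Expand \<open>n mod p\<close> as a finite Fourier series in the additive characters
  modulo \<open>p\<close>. The constant term contributes \<open>p choose 2\<close>; each other frequency contributes
  its coefficient times a quadratic exponential sum of modulus \<open>sqrt p\<close>. The coefficient at
  \<open>a\<close> has modulus \<open>1 / (2 sin (pi a / p))\<close>, and these add up to at most \<open>p ln p\<close>, which gives
  the bound with constant 1 for all odd primes. Divisibility by \<open>p\<close> holds because
  the sums of \<open>x\<close> and of \<open>x\<^sup>2\<close> over all residues vanish modulo \<open>p > 3\<close>.
\<close>

section \<open>Additive characters modulo \<open>p\<close>\<close>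

definition add_char :: "nat \<Rightarrow> int \<Rightarrow> complex" where
  "add_char p n = cis (2 * pi * of_int n / of_nat p)"

lemma norm_add_char [simp]: "norm (add_char p n) = 1"
  by (simp add: add_char_def)

lemma add_char_0 [simp]: "add_char p 0 = 1"
  by (simp add: add_char_def)

lemma add_char_add: "add_char p (m + n) = add_char p m * add_char p n"
  by (simp add: add_char_def cis_mult add_divide_distrib ring_distribs)

lemma cnj_add_char: "cnj (add_char p n) = add_char p (- n)"
  by (simp add: add_char_def cis_cnj)

lemma add_char_power: "add_char p n ^ k = add_char p (n * int k)"
  by (induction k) (simp_all add: add_char_add ring_distribs mult.commute)

lemma add_char_eq_1_iff:
  assumes "p > 0"
  shows "add_char p n = 1 \<longleftrightarrow> int p dvd n"
proof
  assume "int p dvd n"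
  then obtain k where "n = int p * k" ..
  with assms have "2 * pi * of_int n / of_nat p = 2 * pi * of_int k"
    by simp
  then show "add_char p n = 1"
    unfolding add_char_def by (metis Ints_of_int cis_multiple_2pi)
next
  assume "add_char p n = 1"
  then have "cos (2 * pi * of_int n / of_nat p) = 1"
    unfolding add_char_def by (metis cis.sel(1) one_complex.sel(1))
  then obtain k :: int where "2 * pi * of_int n / of_nat p = of_int k * 2 * pi"
    by (auto simp only: cos_one_2pi_int)
  with assms have "real_of_int n = real_of_int (k * int p)"
    by (simp add: field_simps)
  then have "n = k * int p"
    by linarith
  then show "int p dvd n" by simp
qed

lemma add_char_cong:
  assumes "p > 0" and "int p dvd m - n"
  shows "add_char p m = add_char p n"
  using assms add_char_add[of p "m - n" n] by (simp add: add_char_eq_1_iff)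

text \<open>Orthogonality: when \<open>p\<close> does not divide \<open>a\<close>, this is a full
  geometric sum over a \<open>p\<close>-th root of unity other than 1.\<close>

lemma sum_add_char:
  assumes "p > 0"
  shows "(\<Sum>x<p. add_char p (a * int x)) = (if int p dvd a then of_nat p else 0)"
proof (cases "int p dvd a")
  case True
  then have "add_char p (a * int x) = 1" for x
    using assms by (simp add: add_char_eq_1_iff)
  with True show ?thesis by simp
next
  case False
  then have "add_char p a \<noteq> 1" using assms by (simp add: add_char_eq_1_iff)
  moreover have "add_char p a ^ p = 1"
    using assms by (simp add: add_char_power add_char_eq_1_iff)
  ultimately have "(\<Sum>x<p. add_char p a ^ x) = 0"
    by (simp add: geometric_sum)
  with False show ?thesis by (simp add: add_char_power)
qed

section \<open>Quadratic exponential sums\<close>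

text \<open>Moving the window by one drops its first term and appends an equal one, by
  periodicity.\<close>

lemma sum_periodic_shift:
  fixes h :: "int \<Rightarrow> 'a::ab_group_add"
  assumes "\<And>n. h (n + int p) = h n"
  shows "(\<Sum>x<p. h (int x + int y)) = (\<Sum>x<p. h (int x))"
proof (induction y)
  case (Suc y)
  have "(\<Sum>x<p. h (int x + int (Suc y))) = (\<Sum>x<p. h (int (Suc x) + int y))"
    by (simp add: algebra_simps)
  also have "\<dots> = (\<Sum>x<p. h (int x + int y))"
    using sum.lessThan_Suc_shift[of "\<lambda>x. h (int x + int y)" p] assms[of "int y"]
    by (simp add: algebra_simps)
  finally show ?case using Suc.IH by simp
qed simp

text \<open>Squaring the sum and substituting \<open>x = y + d\<close> leaves sums over \<open>y\<close> of the linear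
  characters \<open>2 a d y\<close>, of which only \<open>d = 0\<close> survives.\<close>

lemma norm_quadratic_sum:
  assumes "prime p" and "p > 2" and "\<not> int p dvd a"
  shows "norm (\<Sum>x<p. add_char p (a * int x ^ 2 + b * int x + c)) = sqrt (of_nat p)"
proof -
  define f :: "int \<Rightarrow> int" where "f x = a * x ^ 2 + b * x + c" for x
  define G where "G = (\<Sum>x<p. add_char p (f (int x)))"
  have p0: "p > 0" using assms by simp
  \<comment> \<open>Oddness of \<open>p\<close> enters here: \<open>2 * a\<close> is invertible
    modulo \<open>p\<close>.\<close>
  have dvd_iff: "int p dvd 2 * a * int d \<longleftrightarrow> d = 0" if "d < p" for d
  proof
    assume "int p dvd 2 * a * int d"
    moreover have "prime (int p)" using assms by simp
    moreover have "\<not> int p dvd 2"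
      using assms by (auto dest: zdvd_imp_le)
    ultimately have "int p dvd int d"
      using assms(3) by (simp add: prime_dvd_mult_iff)
    with that show "d = 0" by (auto dest: dvd_imp_le)
  qed simp
  have "G * cnj G = (\<Sum>y<p. \<Sum>x<p. add_char p (f (int x) - f (int y)))"
    unfolding G_def cnj_sum sum_product
    by (subst sum.swap) (simp add: cnj_add_char add_char_add[symmetric])
  also have "\<dots> = (\<Sum>y<p. \<Sum>d<p. add_char p (f (int d + int y) - f (int y)))"
  proof (rule sum.cong[OF refl], rule sum_periodic_shift[symmetric])
    fix y and n :: int
    have "f (n + int p) - f (int y) - (f n - f (int y)) = int p * (a * (2 * n + int p) + b)"
      by (simp add: f_def algebra_simps power2_eq_square)
    then show "add_char p (f (n + int p) - f (int y)) = add_char p (f n - f (int y))"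
      by (intro add_char_cong p0) simp
  qed
  \<comment> \<open>The difference f(d + y) - f(y) is linear in y: the squares of y and the constant
    \<open>c\<close> cancel.\<close>
  also have "\<dots> = (\<Sum>d<p. \<Sum>y<p. add_char p (a * int d ^ 2 + b * int d) *
                                  add_char p (2 * a * int d * int y))"
    by (subst sum.swap)
      (simp add: add_char_add[symmetric] f_def algebra_simps power2_eq_square)
  also have "\<dots> = (\<Sum>d<p. if d = 0 then of_nat p else 0)"
    unfolding sum_distrib_left[symmetric] sum_add_char[OF p0]
    by (intro sum.cong) (auto simp: dvd_iff)
  also have "\<dots> = of_nat p"
    using p0 by simp
  finally have "complex_of_real (norm G ^ 2) = complex_of_real (of_nat p)"
    unfolding complex_norm_square of_real_of_nat_eq .
  then have "norm G ^ 2 = of_nat p"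
    unfolding of_real_eq_iff .
  then have "norm G = sqrt (of_nat p)"
    by (intro real_sqrt_unique[symmetric]) simp_all
  then show ?thesis
    by (simp add: G_def f_def)
qed

section \<open>Size of the Fourier coefficients\<close>

text \<open>Summation by parts. At a root of unity \<open>z\<close> other than 1 with
  \<open>z ^ n = 1\<close> the geometric sum vanishes, which evaluates the Fourier
  coefficients.\<close>

lemma sum_arith_geometric:
  fixes z :: "'a::comm_ring_1"
  shows "(z - 1) * (\<Sum>v<n. of_nat v * z ^ v) = of_nat n * z ^ n - z * (\<Sum>v<n. z ^ v)"
  by (induction n) (simp_all add: algebra_simps)

text \<open>This lower bound is weaker than the chord bound but symmetric under t -> 1 - t, and its
  reciprocal splits into partial fractions, hence later into harmonic sums.\<close>

lemma sin_pi_mult_ge: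
  assumes "0 \<le> t" and "t \<le> 1"
  shows "sin (pi * t) \<ge> 2 * t * (1 - t)"
proof -
  have concave: "concave_on {0..pi/2} sin"
    by (rule f''_le0_imp_concave[where f' = cos and f'' = "\<lambda>x. - sin x"])
      (auto intro!: derivative_eq_intros sin_ge_zero)
  have half: "sin (pi * s) \<ge> 2 * s * (1 - s)" if "0 \<le> s" "s \<le> 1 / 2" for s
  proof -
    \<comment> \<open>By concavity, sine lies above its chord from 0 to pi/2, here at the point with
      weight 2s.\<close>
    have "(1 - 2 * s) * sin 0 + 2 * s * sin (pi / 2) \<le>
        sin ((1 - 2 * s) *\<^sub>R 0 + (2 * s) *\<^sub>R (pi / 2))"
      by (rule concave_onD[OF concave]) (use that in auto)
    then have "2 * s \<le> sin (pi * s)" by (simp add: mult.commute)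
    moreover have "2 * s * (1 - s) \<le> 2 * s * 1"
      using that by (intro mult_left_mono) auto
    ultimately show ?thesis by simp
  qed
  show ?thesis
  proof (cases "t \<le> 1 / 2")
    case True
    with assms half show ?thesis by blast
  next
    case False
    with assms half[of "1 - t"] have "2 * (1 - t) * t \<le> sin (pi - pi * t)"
      by (simp add: algebra_simps)
    then show ?thesis by (simp add: algebra_simps)
  qed
qed

lemma norm_add_char_diff_1:
  assumes "0 < a" and "a < p"
  shows "norm (add_char p (- int a) - 1) \<ge> 4 * (a / p) * (1 - a / p)"
proof -
  have "norm (add_char p (- int a) - 1) = norm (exp (\<i> * of_real (2 * pi * (- real a) / p)) - 1)"
    by (simp add: add_char_def cis_conv_exp)
  also have "\<dots> = 2 * \<bar>sin (pi * (a / p))\<bar>"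
    unfolding dist_exp_i_1 by simp
  also have "\<dots> \<ge> 2 * (2 * (a / p) * (1 - a / p))"
    using sin_pi_mult_ge[of "a / p"] assms by simp
  finally show ?thesis by (simp add: mult.assoc)
qed

text \<open>These are \<open>p\<close> times the Fourier coefficients of \<open>n mod p\<close>.\<close>

definition sawtooth_coeff :: "nat \<Rightarrow> nat \<Rightarrow> complex" where
  "sawtooth_coeff p a = (\<Sum>w<p. of_nat w * add_char p (- int a * int w))"

text \<open>Fourier inversion: after exchanging the sums, orthogonality keeps only the
  \<open>w\<close> congruent to \<open>n\<close>.\<close>

lemma sawtooth_expansion:
  assumes "p > 0"
  shows "of_nat p * of_int (n mod int p) =
    (\<Sum>a<p. sawtooth_coeff p a * add_char p (int a * n))"
proof -
  define v where "v = nat (n mod int p)"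
  have v: "v < p" "int v = n mod int p"
    using assms by (simp_all add: v_def nat_less_iff)
  have dvd_iff: "int p dvd n - int w \<longleftrightarrow> w = v" if "w < p" for w
  proof -
    have "int p dvd n - int w \<longleftrightarrow> n mod int p = int w mod int p"
      by (simp add: mod_eq_dvd_iff)
    with that show ?thesis by (simp flip: v(2)) auto
  qed
  have "(\<Sum>a<p. sawtooth_coeff p a * add_char p (int a * n)) =
      (\<Sum>w<p. of_nat w * (\<Sum>a<p. add_char p ((n - int w) * int a)))"
    unfolding sawtooth_coeff_def sum_distrib_right sum_distrib_left
    by (subst sum.swap) (simp add: mult.assoc add_char_add[symmetric] algebra_simps)
  also have "\<dots> = (\<Sum>w<p. if w = v then of_nat w * of_nat p else 0)"
    by (intro sum.cong) (auto simp: sum_add_char[OF assms] dvd_iff)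
  also have "\<dots> = of_nat p * of_nat v"
    using v by simp
  also have "of_nat v = (of_int (n mod int p) :: complex)"
    by (simp flip: v(2))
  finally show ?thesis by simp
qed

lemma sawtooth_coeff_0: "sawtooth_coeff p 0 = of_nat (p choose 2)"
proof -
  have "(\<Sum>w<p. w) = p choose 2"
    by (induction p) (simp_all add: numeral_2_eq_2)
  then show ?thesis
    by (simp add: sawtooth_coeff_def flip: of_nat_sum)
qed

text \<open>The coefficient equals p / (z - 1) with \<open>z = add_char p (- int a)\<close>, so a
  lower bound for |z - 1| suffices.\<close>

lemma norm_sawtooth_coeff:
  assumes "0 < a" and "a < p"
  shows "norm (sawtooth_coeff p a) \<le> real p ^ 2 / 4 * (1 / real a + 1 / real (p - a))"
proof -
  define z where "z = add_char p (- int a)"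
  have "\<not> int p dvd - int a" using assms by (auto dest: dvd_imp_le)
  then have z: "z \<noteq> 1" "z ^ p = 1"
    using assms by (auto simp: z_def add_char_power add_char_eq_1_iff)
  have "(z - 1) * sawtooth_coeff p a = (z - 1) * (\<Sum>v<p. of_nat v * z ^ v)"
    by (simp add: sawtooth_coeff_def z_def add_char_power)
  also have "\<dots> = of_nat p"
    unfolding sum_arith_geometric using z by (simp add: geometric_sum)
  finally have "norm (z - 1) * norm (sawtooth_coeff p a) = p"
    by (metis norm_mult norm_of_nat)
  with z have "norm (sawtooth_coeff p a) = p / norm (z - 1)"
    by (simp add: field_simps)
  also have "\<dots> \<le> p / (4 * (a / p) * (1 - a / p))"
    using norm_add_char_diff_1[OF assms] assms
    by (intro divide_left_mono mult_pos_pos) (auto simp: z_def z[unfolded z_def])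
  \<comment> \<open>Partial fractions of 1 / (a (p - a)).\<close>
  also have "\<dots> = real p ^ 2 / 4 * (1 / real a + 1 / real (p - a))"
    using assms by (simp add: of_nat_diff field_simps power2_eq_square)
  finally show ?thesis .
qed

text \<open>Since H_n - ln n decreases from its value 1 at n = 1, the left side is at most 1 + ln p;
  and 1 <= ln p because p >= 3 > e.\<close>

lemma harm_le_2_ln:
  assumes "p > 2"
  shows "harm (p - 1) \<le> 2 * ln (real p)"
proof -
  have "harm (p - 1) - ln (real (p - 1)) \<le> harm 1 - ln (real 1)"
    using assms by (intro euler_mascheroni_sequence_decreasing) auto
  moreover have "ln (real (p - 1)) \<le> ln (real p)"
    using assms by simp
  moreover have "exp 1 \<le> real p"
    using exp_le assms by linarith
  then have "1 \<le> ln (real p)"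
    using assms by (simp add: ln_ge_iff)
  ultimately show ?thesis
    by (simp add: harm_def)
qed

lemma sum_norm_sawtooth_coeff:
  assumes "p > 2"
  shows "(\<Sum>a=1..<p. norm (sawtooth_coeff p a)) \<le> p ^ 2 * ln p"
proof -
  have harm: "(\<Sum>a=1..<p. 1 / real a) = harm (p - 1)"
    using assms by (auto simp: harm_def inverse_eq_divide intro!: sum.cong)
  \<comment> \<open>The reflection a -> p - a identifies the two harmonic sums.\<close>
  have "(\<Sum>a=1..<p. 1 / real (p - a)) = (\<Sum>a=1..<p. 1 / real a)"
    by (rule sum.reindex_bij_witness[where i = "\<lambda>a. p - a" and j = "\<lambda>a. p - a"]) auto
  with harm have "(\<Sum>a=1..<p. p ^ 2 / 4 * (1 / real a + 1 / real (p - a))) = p ^ 2 / 2 * harm (p - 1)"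
    by (simp only: sum_distrib_left[symmetric] sum.distrib) simp
  moreover have "\<dots> \<le> p ^ 2 / 2 * (2 * ln (real p))"
    using harm_le_2_ln[OF assms] by (intro mult_left_mono) auto
  moreover have "(\<Sum>a=1..<p. norm (sawtooth_coeff p a)) \<le>
      (\<Sum>a=1..<p. p ^ 2 / 4 * (1 / real a + 1 / real (p - a)))"
    by (intro sum_mono) (use norm_sawtooth_coeff in auto)
  ultimately show ?thesis by simp
qed

section \<open>The deviation from the mean value\<close>

lemma quadratic_residue_sum_bound:
  fixes p :: nat and a b c :: int
  assumes "prime p" and "p > 2" and "\<not> int p dvd a"
  defines "f \<equiv> \<lambda>x::nat. a * int x ^ 2 + b * int x + c"
  shows "\<bar>real_of_int (\<Sum>x<p. f x mod int p) - real (p choose 2)\<bar> \<le> p * sqrt p * ln p"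
proof -
  define G where "G k = (\<Sum>x<p. add_char p (int k * f x))" for k
  have p0: "p > 0" using assms by simp
  have norm_G: "norm (G k) = sqrt p" if "0 < k" "k < p" for k
  proof -
    have "\<not> int p dvd int k * a"
    proof
      assume "int p dvd int k * a"
      with assms have "int p dvd int k"
        by (simp add: prime_dvd_mult_iff)
      with that show False by (auto dest: dvd_imp_le)
    qed
    from norm_quadratic_sum[OF assms(1,2) this, of "int k * b" "int k * c"] show ?thesis
      by (simp add: G_def f_def algebra_simps)
  qed
  have "of_nat p * of_int (\<Sum>x<p. f x mod int p) = (\<Sum>k<p. sawtooth_coeff p k * G k)"
    unfolding of_int_sum sum_distrib_left sawtooth_expansion[OF p0] G_def
    by (rule sum.swap)
  \<comment> \<open>Frequency 0 is split off as the main term; there every character value is 1, so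
    \<open>G 0\<close> is \<open>p\<close>.\<close>
  also have "\<dots> = of_nat p * of_nat (p choose 2) + (\<Sum>k=1..<p. sawtooth_coeff p k * G k)"
    using p0 by (simp add: lessThan_atLeast0 sum.atLeast_Suc_lessThan sawtooth_coeff_0 G_def)
  finally have "of_real (p * (real_of_int (\<Sum>x<p. f x mod int p) - real (p choose 2))) =
      (\<Sum>k=1..<p. sawtooth_coeff p k * G k)"
    by (simp add: algebra_simps)
  then have "norm (of_real (p * (real_of_int (\<Sum>x<p. f x mod int p) - real (p choose 2))) :: complex) =
      norm (\<Sum>k=1..<p. sawtooth_coeff p k * G k)"
    by (rule arg_cong)
  then have "p * \<bar>real_of_int (\<Sum>x<p. f x mod int p) - real (p choose 2)\<bar> =
      norm (\<Sum>k=1..<p. sawtooth_coeff p k * G k)"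
    by (simp only: norm_of_real abs_mult abs_of_nat)
  also have "\<dots> \<le> (\<Sum>k=1..<p. norm (sawtooth_coeff p k * G k))"
    by (rule norm_sum)
  also have "\<dots> = (\<Sum>k=1..<p. norm (sawtooth_coeff p k)) * sqrt p"
    unfolding sum_distrib_right by (intro sum.cong) (auto simp: norm_mult norm_G)
  also have "\<dots> \<le> p ^ 2 * ln p * sqrt p"
    using sum_norm_sawtooth_coeff[OF assms(2)] by (intro mult_right_mono) simp_all
  also have "\<dots> = p * (p * sqrt p * ln p)"
    by (simp add: power2_eq_square)
  finally show ?thesis
    using p0 by (simp only: mult_le_cancel_left_pos of_nat_0_less_iff)
qed

section \<open>Divisibility by \<open>p\<close>\<close>

lemma six_sum_squares: "6 * (\<Sum>x<n. int x ^ 2) = int n * (int n - 1) * (2 * int n - 1)"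
  by (induction n) (simp_all add: algebra_simps power2_eq_square)

lemma two_sum_nat: "2 * (\<Sum>x<n. int x) = int n * (int n - 1)"
  by (induction n) (simp_all add: algebra_simps)

text \<open>Both power sums become multiples of \<open>p\<close> after multiplication by 6 or 2, and
  these factors are invertible modulo a prime above 3.\<close>

lemma dvd_quadratic_residue_sum:
  assumes "prime p" and "p > 3"
  shows "int p dvd (\<Sum>x<p. (a * int x ^ 2 + b * int x + c) mod int p)"
proof -
  have prime: "prime (int p)" using assms by simp
  have not_dvd: "\<not> int p dvd 2" "\<not> int p dvd 3"
    using assms by (auto dest!: zdvd_imp_le)
  have "int p dvd 2 * 3 * (\<Sum>x<p. int x ^ 2)" "int p dvd 2 * (\<Sum>x<p. int x)"
    using six_sum_squares[of p] two_sum_nat[of p] by simp_all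
  then have "int p dvd (\<Sum>x<p. int x ^ 2)" "int p dvd (\<Sum>x<p. int x)"
    using not_dvd unfolding prime_dvd_mult_iff[OF prime] by blast+
  then have "int p dvd a * (\<Sum>x<p. int x ^ 2) + b * (\<Sum>x<p. int x) + int p * c"
    by simp
  also have "\<dots> = (\<Sum>x<p. a * int x ^ 2 + b * int x + c)"
    by (simp add: sum.distrib sum_distrib_left)
  finally show ?thesis
    by (simp add: dvd_eq_mod_eq_0 mod_sum_eq)
qed

section \<open>Counting the points column by column\<close>

lemma card_below_parabola:
  assumes "p > 1"
  shows "int (card (below_parabola p \<alpha> \<beta> \<gamma>)) =
    (\<Sum>x<p. (\<alpha> * int x ^ 2 + \<beta> * int x + \<gamma>) mod int p)"
proof -
  define g where "g x = (\<alpha> * x ^ 2 + \<beta> * x + \<gamma>) mod int p" for x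
  interpret residues "int p" "residue_ring (int p)"
    using assms by unfold_locales simp_all
  have g: "0 \<le> g x" "g x < int p" for x
    using assms by (simp_all add: g_def)
  have pow: "x [^]\<^bsub>residue_ring (int p)\<^esub> (2::nat) = x ^ 2 mod int p" for x
    by (simp add: numeral_2_eq_2 res_mult_eq res_one_eq mod_simps)
  \<comment> \<open>Requiring \<open>y\<close> to lie in the field adds only
    \<open>0 \<le> y\<close>, since \<open>g x < int p\<close>.\<close>
  have "below_parabola p \<alpha> \<beta> \<gamma> = (SIGMA x:{0..<int p}. {0..<g x})"
    by (auto simp: below_parabola_def Let_def res_carrier_eq res_add_eq res_mult_eq
      pow g_def mod_simps intro: less_trans[OF _ g(2)[unfolded g_def]])
  then have "int (card (below_parabola p \<alpha> \<beta> \<gamma>)) = (\<Sum>x\<in>{0..<int p}. g x)"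
    using g(1) by simp
  also have "\<dots> = (\<Sum>x<p. g (int x))"
    by (rule sum.reindex_bij_witness[where i = int and j = nat]) auto
  finally show ?thesis by (simp add: g_def)
qed

theorem theorem3p3:
  fixes p :: nat and \<alpha> \<beta> \<gamma> :: int
  assumes "prime p" and "p > 2"
    and "\<alpha> \<in> carrier (residue_ring (int p))"
    and "\<beta> \<in> carrier (residue_ring (int p))"
    and "\<gamma> \<in> carrier (residue_ring (int p))"
    and "\<alpha> \<noteq> \<zero>\<^bsub>residue_ring (int p)\<^esub>"
  shows "\<bar>real (card (below_parabola p \<alpha> \<beta> \<gamma>)) - real (p choose 2)\<bar>
           \<le> bound_const p * real p * sqrt (real p) * ln (real p)
         \<and> (p \<noteq> 3 \<longrightarrow> p dvd card (below_parabola p \<alpha> \<beta> \<gamma>))"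
proof
  have "\<not> int p dvd \<alpha>"
    using assms by (auto simp: residue_ring_def dest: zdvd_imp_le)
  then have "\<bar>real (card (below_parabola p \<alpha> \<beta> \<gamma>)) - real (p choose 2)\<bar> \<le> p * sqrt p * ln p"
    using quadratic_residue_sum_bound[OF assms(1,2)] assms(2)
      card_below_parabola[of p, THEN arg_cong[where f = real_of_int]]
    by simp
  \<comment> \<open>All three values of \<open>bound_const\<close> are at least 1.\<close>
  also have "\<dots> \<le> bound_const p * (p * sqrt p * ln p)"
    using mult_right_mono[of 1 "bound_const p" "p * sqrt p * ln p"] assms(2)
    by (simp add: bound_const_def)
  finally show "\<bar>real (card (below_parabola p \<alpha> \<beta> \<gamma>)) - real (p choose 2)\<bar>
      \<le> bound_const p * real p * sqrt (real p) * ln (real p)"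
    by (simp add: mult.assoc)
  show "p \<noteq> 3 \<longrightarrow> p dvd card (below_parabola p \<alpha> \<beta> \<gamma>)"
  proof
    assume "p \<noteq> 3"
    with assms have "int p dvd int (card (below_parabola p \<alpha> \<beta> \<gamma>))"
      by (simp add: card_below_parabola dvd_quadratic_residue_sum)
    then show "p dvd card (below_parabola p \<alpha> \<beta> \<gamma>)" by simp
  qed
qed

end
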